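(* Consider the random monotone cellular automaton on $\Lambda=\mathbb Z^3$ (with additive group structure) with $m=1$ and either of the following two choices: (a) $\varphi_1(x)=\mathrm{round}\big([x(1,0,0)+x(0,1,0)+x(0,0,1)]/3\big)$ with height function $h(i)=i_1+i_2+i_3$; (b) $\varphi_1(x)=\mathrm{round}\big([x(1,0,-1)+x(0,1,-1)+x(0,0,-1)]/3\big)$ with height function $h(i)=-i_3$. In both cases the critical noise parameter satisfies $p_{\rm c}\geq 1/12000$.
   Context: Setting of random monotone cellular automata: $\Lambda$ is a countable group with unit $0$, written multiplicatively $(i,j)\mapsto ij$ (for $\mathbb Z^3$ this is addition). A height function is a group homomorphism $h:\Lambda\to(\mathbb Z,+)$. A map $\varphi:\{0,1\}^\Lambda\to\{0,1\}$ is local if it depends on finitely many coordinates, and $\Delta(\varphi)$ denotes the smallest set of coordinates on which it depends; it is monotone if $x\le y$ coordinatewise implies $\varphi(x)\le\varphi(y)$. Let $\varphi_0$ be the constant-zero map and $\varphi_1,\dots,\varphi_m$ non-constant local monotone maps with $\Delta(\varphi_k)\subset\{i\in\Lambda:h(i)=1\}$. Let $\mathbf r$ be a probability distribution on $\{1,\dots,m\}$ (here $m=1$, so $\mathbf r$ is trivial), $p\in[0,1]$, and $(\mu(i))_{i\in\Lambda}$ i.i.d. with $\mathbb P[\mu(i)=0]=p$ and $\mathbb P[\mu(i)=k]=(1-p)\mathbf r(k)$ for $1\le k\le m$. Define $\Phi^p_i(x):=\varphi_{\mu(i)}\big((x(ij))_{j\in\Lambda}\big)$. A trajectory is a configuration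 $x\in\{0,1\}^\Lambda$ with $x(i)=\Phi^p_i(x)$ for all $i$; there is a maximal trajectory $\overline X^p$ (pointwise above every trajectory). The density $\overline\rho(p):=\mathbb P[\overline X^p(i)=1]$ does not depend on $i$, and $p_{\rm c}:=\sup\{p\ge0:\overline\rho(p)>0\}$. $\mathrm{round}$ denotes rounding to the nearest integer (i.e. majority of three bits). *)

theory Defs
  imports "HOL-Probability.Probability"
begin

type_synonym site = "int \<times> int \<times> int"
type_synonym config = "site \<Rightarrow> bool"

fun add3 :: "site \<Rightarrow> site \<Rightarrow> site" where
  "add3 (a, b, c) (d, e, f) = (a + d, b + e, c + f)"

definition local_map_on :: "(config \<Rightarrow> bool) \<Rightarrow> site set \<Rightarrow> bool" where
  "local_map_on phi D \<longleftrightarrow> (\<forall>x y. (\<forall>j\<in>D. x j = y j) \<longrightarrow> phi x = phi y)"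

text \<open>The random map: omega i = True means mu(i) = 1 (apply phi_1), False means mu(i) = 0
  (apply the constant-zero map phi_0).  Trajectories are the fixed points of this operator.\<close>
definition traj_op :: "(config \<Rightarrow> bool) \<Rightarrow> config \<Rightarrow> config \<Rightarrow> config" where
  "traj_op phi \<omega> x = (\<lambda>i. \<omega> i \<and> phi (\<lambda>j. x (add3 i j)))"

definition is_trajectory :: "(config \<Rightarrow> bool) \<Rightarrow> config \<Rightarrow> config \<Rightarrow> bool" where
  "is_trajectory phi \<omega> x \<longleftrightarrow> (\<forall>i. x i = traj_op phi \<omega> x i)"

definition max_traj :: "(config \<Rightarrow> bool) \<Rightarrow> config \<Rightarrow> config" where
  "max_traj phi \<omega> = gfp (traj_op phi \<omega>)"

definition noise :: "real \<Rightarrow> config measure" where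
  "noise p = PiM UNIV (\<lambda>_. measure_pmf (bernoulli_pmf (1 - p)))"

definition rho_bar :: "(config \<Rightarrow> bool) \<Rightarrow> real \<Rightarrow> real" where
  "rho_bar phi p = measure (noise p) {\<omega> \<in> space (noise p). max_traj phi \<omega> (0, 0, 0)}"

definition p_crit :: "(config \<Rightarrow> bool) \<Rightarrow> real" where
  "p_crit phi = Sup {p. 0 \<le> p \<and> p \<le> 1 \<and> rho_bar phi p > 0}"

definition phi_a :: "config \<Rightarrow> bool" where
  "phi_a x = (round ((of_bool (x (1, 0, 0)) + of_bool (x (0, 1, 0)) + of_bool (x (0, 0, 1))) / 3 :: real) = 1)"

definition phi_b :: "config \<Rightarrow> bool" where
  "phi_b x = (round ((of_bool (x (1, 0, -1)) + of_bool (x (0, 1, -1)) + of_bool (x (0, 0, -1))) / 3 :: real) = 1)"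

definition h_a :: "site \<Rightarrow> int" where "h_a i = (case i of (a, b, c) \<Rightarrow> a + b + c)"
definition h_b :: "site \<Rightarrow> int" where "h_b i = (case i of (a, b, c) \<Rightarrow> - c)"

end

theory Submission
  imports Defs
begin

text \<open>
  A linear automorphism of the lattice turns both rules into the same one: a site is \<open>0\<close> iff it is
  noisy or at least two of its parents \<open>v + e\<^sub>1\<close>, \<open>v + e\<^sub>2\<close>, \<open>v + e\<^sub>3\<close> are \<open>0\<close>.

  An explanation of a zero is a system of noisy sites held together by three poles \<open>i\<^sub>1\<close>, \<open>i\<^sub>2\<close>, \<open>i\<^sub>3\<close>
  of equal height, which all sit at the zero itself to begin with.  One can either move every pole
  to a zero parent, pole \<open>s\<close> avoiding the direction \<open>e\<^sub>s\<close> (possible, as two parents are zero), or cut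
  a fork, i.e. a pair of zero parents of a common child whose histories are disjoint, and
  distribute the three poles over the two parts, each part receiving its end of the fork as a
  replacement for the missing poles.  The span
  \<open>height - (\<ell>\<^sub>1(i\<^sub>1) + \<ell>\<^sub>2(i\<^sub>2) + \<ell>\<^sub>3(i\<^sub>3))\<close> grows by one with every move, and a cut lowers the
  total span by at most one.  Since it vanishes at the root and at a single noisy site, there are at
  most as many moves as cuts, that is fewer moves than noisy sites.

  A move leaves 8 possibilities and a cut at most 27, so the sum \<open>S\<close> over all explanations,
  with weight \<open>24p\<close> per noisy site and \<open>1/24\<close> per move, satisfies
  \<open>S \<le> 24p + 8S/24 + 27S\<^sup>2\<close>.  For \<open>p = 1/12000\<close> this keeps \<open>S \<le> 1/200\<close>, and the origin is \<open>0\<close>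
  with probability at most \<open>S/24 < 1\<close>.
\<close>

section \<open>Codes and their total weight\<close>

text \<open>\<open>Join s a b c d\<close> reassembles a cut that separates pole \<open>s\<close>, contained in \<open>c\<close>, from the other two;
  the two ends of the fork differ by \<open>e a - e b\<close>.\<close>

datatype code = Leaf | Up "3 \<Rightarrow> 3" code | Join 3 3 3 code code

primrec leaves :: "code \<Rightarrow> nat" where
  "leaves Leaf = 1"
| "leaves (Up j c) = leaves c"
| "leaves (Join s a b c d) = leaves c + leaves d"

primrec ups :: "code \<Rightarrow> nat" where
  "ups Leaf = 0"
| "ups (Up j c) = Suc (ups c)"
| "ups (Join s a b c d) = ups c + ups d"

definition moves :: "(3 \<Rightarrow> 3) set" where
  "moves = {j. \<forall>s. j s \<noteq> s}"

text \<open>Bounding the nesting depth makes these sets finite; estimates uniform in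
  \<open>n\<close> pass to the limit at the end.\<close>

primrec codes :: "nat \<Rightarrow> code set" where
  "codes 0 = {}"
| "codes (Suc n) = insert Leaf
     (case_prod Up ` (moves \<times> codes n) \<union>
      (\<lambda>((s, a, b), (c, d)). Join s a b c d) ` (UNIV \<times> (codes n \<times> codes n)))"

lemma finite_moves: "finite moves"
  by (rule finite)

lemma card_moves: "card moves = 8"
proof -
  have "moves = (\<Pi>\<^sub>E s\<in>UNIV. UNIV - {s})"
    by (auto simp: moves_def PiE_def extensional_def)
  then have "card moves = (\<Prod>s\<in>(UNIV :: 3 set). card (UNIV - {s} :: 3 set))"
    using card_PiE[of UNIV "\<lambda>s :: 3. UNIV - {s}"] by (simp only: finite)
  also have "\<dots> = 8"
    by (simp add: card_Diff_singleton)
  finally show ?thesis .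
qed

lemma finite_codes: "finite (codes n)"
  by (induction n) (auto simp: finite_moves)

lemma codes_Suc_mono: "codes n \<subseteq> codes (Suc n)"
proof (induction n)
  case (Suc n)
  show ?case
  proof
    fix c assume "c \<in> codes (Suc n)"
    then show "c \<in> codes (Suc (Suc n))"
      using Suc unfolding codes.simps(2)[of "Suc n"] by (subst (asm) codes.simps(2)) blast
  qed
qed simp

lemma codes_mono: "m \<le> n \<Longrightarrow> codes m \<subseteq> codes n"
  using lift_Suc_mono_le[of codes] codes_Suc_mono by blast

text \<open>\<open>1 / 500\<close> is \<open>24 * p\<close> at \<open>p = 1 / 12000\<close>: the
  factor 24 gained by a leaf pays for the \<open>1 / 24\<close> of a move, since contours have fewer
  moves than leaves.\<close>

definition weight :: "code \<Rightarrow> real" where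
  "weight c = (1 / 500) ^ leaves c * (1 / 24) ^ ups c"

lemma weight_nonneg: "0 \<le> weight c"
  by (simp add: weight_def)

lemma sum_weight_codes_le: "(\<Sum>c\<in>codes n. weight c) \<le> 1 / 200"
proof (induction n)
  case (Suc n)
  let ?W = "\<Sum>c\<in>codes n. weight c"
  let ?U = "case_prod Up ` (moves \<times> codes n)"
  let ?J = "(\<lambda>((s, a, b), (c, d)). Join s a b c d) ` (UNIV \<times> (codes n \<times> codes n))"
  have W0: "0 \<le> ?W"
    by (intro sum_nonneg weight_nonneg)
  have finU: "finite ?U" and finJ: "finite ?J"
    by (simp_all add: finite_moves finite_codes)
  have "sum weight ?U \<le> (\<Sum>x\<in>moves \<times> codes n. weight (case_prod Up x))"
    using sum_image_le[of "moves \<times> codes n" weight "case_prod Up"]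
    by (simp add: finite_moves finite_codes weight_nonneg o_def)
  also have "\<dots> = (\<Sum>(j, c)\<in>moves \<times> codes n. weight c / 24)"
    by (intro sum.cong) (auto simp: weight_def)
  also have "\<dots> = 8 / 24 * ?W"
    by (simp add: sum.cartesian_product[symmetric] card_moves sum_divide_distrib[symmetric])
  finally have U: "sum weight ?U \<le> 8 / 24 * ?W" .
  have "sum weight ?J \<le> (\<Sum>x\<in>UNIV \<times> (codes n \<times> codes n).
      weight ((\<lambda>((s, a, b), (c, d)). Join s a b c d) x))"
    using sum_image_le[of "UNIV \<times> (codes n \<times> codes n)" weight
        "\<lambda>((s, a, b), (c, d)). Join s a b c d"]
    by (simp add: finite_codes weight_nonneg o_def)
  also have "\<dots> = (\<Sum>(x, (c, d))\<in>(UNIV :: (3 \<times> 3 \<times> 3) set) \<times> (codes n \<times> codes n).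
      weight c * weight d)"
    by (intro sum.cong) (auto simp: weight_def power_add)
  also have "\<dots> = 27 * (?W * ?W)"
    by (simp add: sum.cartesian_product[symmetric] sum_product)
  finally have J: "sum weight ?J \<le> 27 * (?W * ?W)" .
  have "sum weight (codes (Suc n)) \<le> weight Leaf + sum weight (?U \<union> ?J)"
    using finU finJ by (simp only: codes.simps sum.insert_if finite_Un)
      (simp add: weight_nonneg)
  also have "sum weight (?U \<union> ?J) \<le> sum weight ?U + sum weight ?J"
    using sum.union_inter[OF finU finJ, of weight] sum_nonneg[of "?U \<inter> ?J" weight]
    by (simp add: weight_nonneg)
  also have "sum weight ?U + sum weight ?J \<le> 8 / 24 * ?W + 27 * (?W * ?W)"
    using U J by simp
  also have "?W * ?W \<le> 1 / 200 * (1 / 200)"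
    using W0 Suc by (intro mult_mono) auto
  \<comment> \<open>Numerically, \<open>1/500 + 1/600 + 27/40000 < 1/200\<close>.\<close>
  also have "weight Leaf + (8 / 24 * ?W + 27 * (1 / 200 * (1 / 200))) \<le> 1 / 200"
    using Suc by (simp add: weight_def)
  finally show ?case by simp
qed simp

lemma ex_3: "(\<exists>s::3. P s) \<longleftrightarrow> P 1 \<or> P 2 \<or> P 3"
  using forall_3[of "\<lambda>s. \<not> P s"] by blast

text \<open>Two values on three poles split one against two; the lone pole is the \<open>s\<close>
  of a join.\<close>

lemma odd_one_out:
  fixes P :: "3 \<Rightarrow> bool"
  assumes "\<not> (\<forall>s. P s = P 1)"
  shows "\<exists>s. \<forall>u. u \<noteq> s \<longrightarrow> P u \<noteq> P s"
  using assms unfolding forall_3 ex_3 by auto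

text \<open>\<open>l\<close> is the basis dual to the parent directions \<open>e\<close>. Both rules
  have this form, so one argument serves both.\<close>

locale majority_lattice =
  fixes e :: "3 \<Rightarrow> 'v::ab_group_add" and l :: "3 \<Rightarrow> 'v \<Rightarrow> int"
  assumes l_add: "l s (x + y) = l s x + l s y"
    and l_e: "l s (e t) = of_bool (s = t)"
begin

definition height :: "'v \<Rightarrow> int" where
  "height v = (\<Sum>s\<in>UNIV. l s v)"

lemma height_add: "height (x + y) = height x + height y"
  by (simp add: height_def l_add sum.distrib)

lemma height_e: "height (e a) = 1"
  by (simp add: height_def l_e of_bool_def)

section \<open>Clusters and the bound on their moves\<close>

text \<open>\<open>cluster N A i\<close>: the noisy sites \<open>N\<close> explain the poles \<open>i\<close>, using \<open>A\<close> moves.\<close>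

inductive cluster :: "'v set \<Rightarrow> nat \<Rightarrow> (3 \<Rightarrow> 'v) \<Rightarrow> bool" where
  noise: "cluster {x} 0 (\<lambda>_. x)"
| up: "cluster N A (\<lambda>s. i s + e (j s)) \<Longrightarrow> j \<in> moves \<Longrightarrow> cluster N (Suc A) i"
| join: "cluster N A (\<lambda>u. if u = s then i s else x) \<Longrightarrow> cluster M B (i(s := y)) \<Longrightarrow>
    N \<inter> M = {} \<Longrightarrow> y + e b = x + e a \<Longrightarrow> cluster (N \<union> M) (A + B) i"

lemma cluster_finite_nonempty: "cluster N A i \<Longrightarrow> finite N \<and> N \<noteq> {}"
  by (induction rule: cluster.induct) auto

text \<open>Induction with the span as potential: a move leaves \<open>A\<close> plus span
  unchanged, and in a join the two strict inequalities leave a spare unit that pays for the span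
  lost in the cut. Equal heights make the span independent of the pole that measures it.\<close>

lemma cluster_ups_bound:
  assumes "cluster N A i"
  shows "(\<forall>s. height (i s) = height (i 1)) \<and>
    int A + height (i 1) - (\<Sum>s\<in>UNIV. l s (i s)) < int (card N)"
  using assms
proof (induction rule: cluster.induct)
  case (noise x)
  show ?case by (simp add: height_def)
next
  case (up N A i j)
  then have "l s (e (j s)) = 0" for s
    by (simp add: l_e moves_def) metis
  with up show ?case
    by (simp add: height_add height_e l_add)
next
  case (join N A s i x M B y b a)
  have fin: "finite N" "finite M"
    using join.hyps cluster_finite_nonempty by blast+
  have hx: "height x = height y"
    using join.hyps(4) height_add[of y "e b"] height_add[of x "e a"] by (simp add: height_e)
  have h1: "height (if u = s then i s else x) = height (if 1 = s then i s else x)" for u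
    using join.IH(1) by blast
  have h2: "height ((i(s := y)) u) = height ((i(s := y)) 1)" for u
    using join.IH(2) by blast
  \<comment> \<open>\<open>s + 1\<close> differs from \<open>s\<close> in type \<open>3\<close>, so
    in the first part its pole is \<open>x\<close>.\<close>
  have his: "height (i s) = height x"
    using h1[of s] h1[of "s + 1"] by simp
  have hi: "height (i u) = height x" for u
    using h2[of u] h2[of s] his hx by (cases "u = s") auto
  \<comment> \<open>The two poles at \<open>x\<close> contribute \<open>height x - l s x\<close>, as
    the functionals sum to the height.\<close>
  have S1: "(\<Sum>u\<in>UNIV. l u (if u = s then i s else x)) = l s (i s) + (height x - l s x)"
    by (simp add: height_def sum.remove[of UNIV s] if_distrib cong: if_cong)
  have S2: "(\<Sum>u\<in>UNIV. l u ((i(s := y)) u)) = l s y + ((\<Sum>u\<in>UNIV. l u (i u)) - l s (i s))"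
    by (simp add: sum.remove[of UNIV s])
  have B1: "int A + height x - (l s (i s) + (height x - l s x)) < int (card N)"
    using join.IH(1) S1 his by (auto split: if_splits)
  have "height ((i(s := y)) 1) = height x"
    using hi hx by simp
  then have B2: "int B + height x - (l s y + ((\<Sum>u\<in>UNIV. l u (i u)) - l s (i s))) < int (card M)"
    using join.IH(2) S2 by metis
  have "l s y + l s (e b) = l s x + l s (e a)"
    using join.hyps(4) l_add by metis
  \<comment> \<open>\<open>l s (e a)\<close> and \<open>l s (e b)\<close> are both 0 or 1.\<close>
  then have "l s y - l s x \<le> 1"
    by (simp add: l_e of_bool_def split: if_splits)
  with B1 B2 hi show ?case
    by (simp add: card_Un_disjoint[OF fin join.hyps(3)])
qed

section \<open>Coding clusters up to translation\<close>

text \<open>A code describes noisy sites and poles only up to a common translation.\<close>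

primrec realize :: "code \<Rightarrow> 'v set \<times> (3 \<Rightarrow> 'v)" where
  "realize Leaf = ({0}, \<lambda>_. 0)"
| "realize (Up j c) = (fst (realize c), \<lambda>s. snd (realize c) s - e (j s))"
| "realize (Join s a b c d) =
    (let t = snd (realize c) (s + 1) + e a - e b - snd (realize d) s
     in (fst (realize c) \<union> (+) t ` fst (realize d),
         \<lambda>u. if u = s then snd (realize c) s else snd (realize d) u + t))"

text \<open>Reduces a union over clusters to one over codes. Disjointness in \<open>join\<close>
  makes the leaves match distinct sites.\<close>

lemma cluster_code:
  assumes "cluster N A i"
  shows "\<exists>c t n. c \<in> codes n \<and> N = (+) t ` fst (realize c) \<and> i = (\<lambda>s. snd (realize c) s + t) \<and>
    leaves c = card N \<and> ups c = A"
  using assms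
proof (induction rule: cluster.induct)
  case (noise x)
  have "Leaf \<in> codes (Suc 0)" by simp
  then show ?case
    by (intro exI[of _ Leaf] exI[of _ x] exI[of _ "Suc 0"]) auto
next
  case (up N A i j)
  then obtain c t n where c: "c \<in> codes n" "N = (+) t ` fst (realize c)"
    "(\<lambda>s. i s + e (j s)) = (\<lambda>s. snd (realize c) s + t)" "leaves c = card N" "ups c = A"
    by blast
  have "Up j c \<in> codes (Suc n)"
    using c(1) up.hyps(2) by auto
  moreover have "i = (\<lambda>s. snd (realize (Up j c)) s + t)"
    using c(3) by (auto simp: fun_eq_iff algebra_simps)
  ultimately show ?case
    using c by (intro exI[of _ "Up j c"] exI[of _ t] exI[of _ "Suc n"]) auto
next
  case (join N A s i x M B y b a)
  obtain c t m where c: "c \<in> codes m" "N = (+) t ` fst (realize c)"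
    "(\<lambda>u. if u = s then i s else x) = (\<lambda>u. snd (realize c) u + t)" "leaves c = card N" "ups c = A"
    using join.IH(1) by blast
  obtain d r n where d: "d \<in> codes n" "M = (+) r ` fst (realize d)"
    "i(s := y) = (\<lambda>u. snd (realize d) u + r)" "leaves d = card M" "ups d = B"
    using join.IH(2) by blast
  have x: "x = snd (realize c) (s + 1) + t"
    using fun_cong[OF c(3), of "s + 1"] by simp
  have isx: "i s = snd (realize c) s + t"
    using fun_cong[OF c(3), of s] by simp
  have y: "y = snd (realize d) s + r"
    using fun_cong[OF d(3), of s] by simp
  have iu: "i u = snd (realize d) u + r" if "u \<noteq> s" for u
    using fun_cong[OF d(3), of u] that by simp
  \<comment> \<open>The shift \<open>t\<close> of \<open>realize\<close>: relative to the first
    part, it moves pole \<open>s\<close> of the second to the other end of the fork.\<close>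
  define q where "q = snd (realize c) (s + 1) + e a - e b - snd (realize d) s"
  have "y = x + e a - e b"
    using join.hyps(4) by (simp add: algebra_simps)
  then have r: "r = q + t"
    unfolding q_def using x y by (simp add: algebra_simps)
  let ?k = "Join s a b c d"
  have "c \<in> codes (max m n)" "d \<in> codes (max m n)"
    using c(1) d(1) codes_mono[of m "max m n"] codes_mono[of n "max m n"] by auto
  then have "?k \<in> codes (Suc (max m n))"
    by (auto simp: image_iff)
  moreover have "N \<union> M = (+) t ` fst (realize ?k)"
    unfolding realize.simps Let_def q_def[symmetric] c(2) d(2) r
    by (auto simp: image_Un image_image ac_simps)
  moreover have "i = (\<lambda>u. snd (realize ?k) u + t)"
    unfolding realize.simps Let_def q_def[symmetric]
    using isx iu r by (auto simp: fun_eq_iff ac_simps)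
  moreover have "card (N \<union> M) = card N + card M"
    using join.hyps cluster_finite_nonempty by (intro card_Un_disjoint) blast+
  ultimately show ?case
    using c d by (intro exI[of _ ?k] exI[of _ t] exI[of _ "Suc (max m n)"]) auto
qed

section \<open>Every zero has a cluster of noisy sites\<close>

primrec zero :: "nat \<Rightarrow> ('v \<Rightarrow> bool) \<Rightarrow> 'v \<Rightarrow> bool" where
  "zero 0 \<omega> v = False"
| "zero (Suc n) \<omega> v =
    (\<not> \<omega> v \<or> (\<exists>a b. a \<noteq> b \<and> zero n \<omega> (v + e a) \<and> zero n \<omega> (v + e b)))"

lemma zero_Suc_mono: "zero n \<omega> v \<Longrightarrow> zero (Suc n) \<omega> v"
proof (induction n arbitrary: v)
  case (Suc n)
  then show ?case
    unfolding zero.simps(2)[of "Suc n"] using zero.simps(2)[of n \<omega> v] by blast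
qed simp

lemma zero_mono: "m \<le> n \<Longrightarrow> zero m \<omega> v \<Longrightarrow> zero n \<omega> v"
  by (induction n rule: dec_induct) (auto simp del: zero.simps intro: zero_Suc_mono)

definition fork :: "'v \<Rightarrow> 'v \<Rightarrow> bool" where
  "fork x y \<longleftrightarrow> (\<exists>a b. y + e b = x + e a)"

lemma fork_sym: "fork x y \<Longrightarrow> fork y x"
  by (metis fork_def)

text \<open>The value \<open>f x\<close> is the set of noisy sites available to the class of \<open>x\<close>, and it also serves as the
  name of that class: distinct classes have disjoint nonempty values.\<close>

definition clustering :: "('v \<Rightarrow> bool) \<Rightarrow> int \<Rightarrow> 'v set \<Rightarrow> ('v \<Rightarrow> 'v set) \<Rightarrow> bool" where
  "clustering \<omega> H V f \<longleftrightarrow>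
    (\<forall>x\<in>V. \<forall>y\<in>V. f x = f y \<or> f x \<inter> f y = {}) \<and>
    (\<forall>x\<in>V. f x \<subseteq> {v. \<not> \<omega> v \<and> H \<le> height v}) \<and>
    (\<forall>i. (\<forall>s. i s \<in> V \<and> f (i s) = f (i 1)) \<longrightarrow> (\<exists>N A. N \<subseteq> f (i 1) \<and> cluster N A i))"

lemma clustering_nonempty:
  assumes "clustering \<omega> H V f" "x \<in> V"
  shows "f x \<noteq> {}"
proof -
  have "\<exists>N A. N \<subseteq> f x \<and> cluster N A (\<lambda>_. x)"
    using assms unfolding clustering_def by (elim conjE allE[of _ "\<lambda>_. x"]) auto
  then show ?thesis
    using cluster_finite_nonempty by blast
qed

text \<open>Fork end \<open>x\<close> replaces the two poles missing from class \<open>f x\<close>,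
  and \<open>y\<close> the one missing from \<open>f y\<close>; the two resulting clusters
  join.\<close>

lemma clustering_join:
  assumes f: "clustering \<omega> H V f" and x: "x \<in> V" and y: "y \<in> V" and fork: "fork x y"
    and ne: "f x \<noteq> f y"
    and i: "\<And>u. i u \<in> V" "f (i s) = f x" "\<And>u. u \<noteq> s \<Longrightarrow> f (i u) = f y"
  shows "\<exists>N A. N \<subseteq> f x \<union> f y \<and> cluster N A i"
proof -
  have tri: "\<exists>N A. N \<subseteq> f z \<and> cluster N A k" if "\<And>u. k u \<in> V" "\<And>u. f (k u) = f z" for k z
    using f that unfolding clustering_def by metis
  have "\<exists>N A. N \<subseteq> f x \<and> cluster N A (\<lambda>u. if u = s then i s else x)"
    by (rule tri) (use x i in auto)
  then obtain N A where N: "N \<subseteq> f x" "cluster N A (\<lambda>u. if u = s then i s else x)"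
    by blast
  have "\<exists>M B. M \<subseteq> f y \<and> cluster M B (i(s := y))"
    by (rule tri) (use y i in auto)
  then obtain M B where M: "M \<subseteq> f y" "cluster M B (i(s := y))"
    by blast
  have "N \<inter> M = {}"
    using f x y ne N M unfolding clustering_def by blast
  moreover obtain a b where "y + e b = x + e a"
    using fork by (auto simp: fork_def)
  ultimately have "cluster (N \<union> M) (A + B) i"
    using N M by (intro cluster.join)
  then show ?thesis
    using N M by blast
qed

text \<open>Poles in the merged class either shared a class before or split one against two, and
  then the fork joins them.\<close>

lemma clustering_merge:
  assumes f: "clustering \<omega> H V f" and x: "x \<in> V" and y: "y \<in> V" and fork: "fork x y"
    and ne: "f x \<noteq> f y"
  shows "clustering \<omega> H V (\<lambda>z. if f z = f x \<or> f z = f y then f x \<union> f y else f z)"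
    (is "clustering \<omega> H V ?g")
proof -
  have disj: "\<And>z w. z \<in> V \<Longrightarrow> w \<in> V \<Longrightarrow> f z = f w \<or> f z \<inter> f w = {}"
    and sub: "\<And>z. z \<in> V \<Longrightarrow> f z \<subseteq> {v. \<not> \<omega> v \<and> H \<le> height v}"
    and tri: "\<And>i. (\<And>s. i s \<in> V \<and> f (i s) = f (i 1)) \<Longrightarrow> \<exists>N A. N \<subseteq> f (i 1) \<and> cluster N A i"
    using f unfolding clustering_def by blast+
  have other: "f z \<inter> (f x \<union> f y) = {}" if "z \<in> V" "f z \<noteq> f x" "f z \<noteq> f y" for z
    using disj[OF that(1) x] disj[OF that(1) y] that by blast
  have "?g z = ?g w \<or> ?g z \<inter> ?g w = {}" if "z \<in> V" "w \<in> V" for z w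
  proof (cases "f z = f x \<or> f z = f y")
    case z: True
    show ?thesis
    proof (cases "f w = f x \<or> f w = f y")
      case True
      with z show ?thesis by simp
    next
      case False
      with z show ?thesis using other[of w] that by (simp add: Int_commute)
    qed
  next
    case z: False
    then show ?thesis
      using other[of z] disj[of z w] that by simp
  qed
  moreover have "?g z \<subseteq> {v. \<not> \<omega> v \<and> H \<le> height v}" if "z \<in> V" for z
    using sub[OF that] sub[OF x] sub[OF y] by simp
  moreover have "\<exists>N A. N \<subseteq> ?g (i 1) \<and> cluster N A i"
    if i: "\<And>s. i s \<in> V \<and> ?g (i s) = ?g (i 1)" for i
  proof (cases "\<forall>s. f (i s) = f (i 1)")
    case True
    then obtain N A where "N \<subseteq> f (i 1)" "cluster N A i"
      using tri[of i] i by blast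
    then show ?thesis by auto
  next
    case False
    \<comment> \<open>A third class cannot have the merged value by accident, being nonempty and
      disjoint from it.\<close>
    have neV: "f z \<noteq> f x \<union> f y" if "z \<in> V" "f z \<noteq> f x" "f z \<noteq> f y" for z
      using other[OF that] clustering_nonempty[OF f that(1)] by blast
    have xy: "f (i s) = f x \<or> f (i s) = f y" for s
    proof (rule ccontr)
      assume s: "\<not> ?thesis"
      have "f (i u) = f (i s)" for u
      proof -
        have g: "?g (i u) = f (i s)"
          using i[of u] i[of s] s by simp
        show ?thesis
        proof (cases "f (i u) = f x \<or> f (i u) = f y")
          case True
          then have "f (i s) = f x \<union> f y"
            using g by simp
          then show ?thesis
            using neV[of "i s"] i[of s] s by blast
        next
          case False
          then show ?thesis using g by simp
        qed
      qed
      then show False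
        using False by metis
    qed
    then have g1: "?g (i 1) = f x \<union> f y" by auto
    have "\<not> (\<forall>s. (f (i s) = f x) = (f (i 1) = f x))"
      using False xy by metis
    then obtain s where "\<forall>u. u \<noteq> s \<longrightarrow> (f (i u) = f x) \<noteq> (f (i s) = f x)"
      using odd_one_out[of "\<lambda>s. f (i s) = f x"] by blast
    then have "f (i s) = f x \<and> (\<forall>u. u \<noteq> s \<longrightarrow> f (i u) = f y) \<or>
        f (i s) = f y \<and> (\<forall>u. u \<noteq> s \<longrightarrow> f (i u) = f x)"
      using xy ne by metis
    then show ?thesis
    proof
      assume *: "f (i s) = f x \<and> (\<forall>u. u \<noteq> s \<longrightarrow> f (i u) = f y)"
      show ?thesis
        unfolding g1 using i * by (intro clustering_join[OF f x y fork ne, of i s]) auto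
    next
      assume *: "f (i s) = f y \<and> (\<forall>u. u \<noteq> s \<longrightarrow> f (i u) = f x)"
      have "\<exists>N A. N \<subseteq> f y \<union> f x \<and> cluster N A i"
        using i * ne by (intro clustering_join[OF f y x fork_sym[OF fork], of i s]) auto
      then show ?thesis
        unfolding g1 by (simp add: Un_commute)
    qed
  qed
  ultimately show ?thesis
    unfolding clustering_def by blast
qed

lemma clustering_add_forks:
  assumes "finite F" "clustering \<omega> H V f"
    and "\<And>x y. (x, y) \<in> F \<Longrightarrow> x \<in> V \<and> y \<in> V \<and> fork x y"
  shows "\<exists>g. clustering \<omega> H V g \<and> (\<forall>(x, y)\<in>F. g x = g y)"
  using assms(1,3)
proof (induction F rule: finite_induct)
  case empty
  then show ?case using assms(2) by auto
next
  case (insert p F)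
  then obtain g where g: "clustering \<omega> H V g" "\<forall>(x, y)\<in>F. g x = g y"
    by blast
  obtain x y where p: "p = (x, y)" by force
  have xy: "x \<in> V" "y \<in> V" "fork x y"
    using insert.prems p by auto
  show ?case
  proof (cases "g x = g y")
    case True
    then show ?thesis using g p by auto
  next
    case False
    show ?thesis
    proof (intro exI conjI)
      show "clustering \<omega> H V (\<lambda>z. if g z = g x \<or> g z = g y then g x \<union> g y else g z)"
        by (rule clustering_merge[OF g(1) xy False])
      show "\<forall>(a, b)\<in>insert p F. (if g a = g x \<or> g a = g y then g x \<union> g y else g a) =
          (if g b = g x \<or> g b = g y then g x \<union> g y else g b)"
      proof clarify
        fix a b assume "(a, b) \<in> insert p F"
        \<comment> \<open>The new value depends on the old one alone, so earlier identifications
          persist.\<close>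
        then have "g a = g b \<or> a = x \<and> b = y"
          using g(2) p by blast
        then show "(if g a = g x \<or> g a = g y then g x \<union> g y else g a) =
            (if g b = g x \<or> g b = g y then g x \<union> g y else g b)"
          by (elim disjE) simp_all
      qed
    qed
  qed
qed

text \<open>Descends from level \<open>H + 1\<close> to \<open>H\<close>: a noise-free site inherits
  the class shared by its two chosen parents, a noisy site forms a class of its own.\<close>

lemma clustering_step:
  assumes V: "\<And>v. v \<in> V \<Longrightarrow> height v = H"
    and par: "\<And>v. v \<in> V \<Longrightarrow> \<omega> v \<Longrightarrow>
      p v \<noteq> q v \<and> v + e (p v) \<in> V' \<and> v + e (q v) \<in> V' \<and> f (v + e (p v)) = f (v + e (q v))"
    and f: "clustering \<omega> (H + 1) V' f"
  shows "clustering \<omega> H V (\<lambda>v. if \<omega> v then f (v + e (p v)) else {v})"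
    (is "clustering \<omega> H V ?g")
proof -
  have disj: "\<And>z w. z \<in> V' \<Longrightarrow> w \<in> V' \<Longrightarrow> f z = f w \<or> f z \<inter> f w = {}"
    and sub: "\<And>z. z \<in> V' \<Longrightarrow> f z \<subseteq> {v. \<not> \<omega> v \<and> H + 1 \<le> height v}"
    and tri: "\<And>i. (\<And>s. i s \<in> V' \<and> f (i s) = f (i 1)) \<Longrightarrow> \<exists>N A. N \<subseteq> f (i 1) \<and> cluster N A i"
    using f unfolding clustering_def by blast+
  have notin: "v \<notin> f z" if "v \<in> V" "z \<in> V'" for v z
    using sub[OF that(2)] V[OF that(1)] by auto
  have "?g z = ?g w \<or> ?g z \<inter> ?g w = {}" if "z \<in> V" "w \<in> V" for z w
    using disj[of "z + e (p z)" "w + e (p w)"] par[of z] par[of w]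
      notin[of z "w + e (p w)"] notin[of w "z + e (p z)"] that
    by (cases "\<omega> z"; cases "\<omega> w"; cases "z = w") simp_all
  moreover have "?g z \<subseteq> {v. \<not> \<omega> v \<and> H \<le> height v}" if "z \<in> V" for z
  proof (cases "\<omega> z")
    case True
    then show ?thesis using sub[of "z + e (p z)"] par[OF that True] by force
  next
    case False
    then show ?thesis using V[OF that] by auto
  qed
  moreover have "\<exists>N A. N \<subseteq> ?g (i 1) \<and> cluster N A i"
    if i: "\<And>s. i s \<in> V \<and> ?g (i s) = ?g (i 1)" for i
  proof (cases "\<omega> (i 1)")
    case True
    \<comment> \<open>Values from level \<open>H + 1\<close> contain no site of height
      \<open>H\<close>, so they differ from the singleton of a noisy pole.\<close>
    have om: "\<omega> (i s)" for s
    proof (rule ccontr)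
      assume n: "\<not> \<omega> (i s)"
      then have "{i s} = f (i 1 + e (p (i 1)))"
        using i[of s] True by simp
      then show False
        using notin[of "i s" "i 1 + e (p (i 1))"] i[of s] i[of 1] par[of "i 1"] True by blast
    qed
    \<comment> \<open>As \<open>p (i s)\<close> and \<open>q (i s)\<close> differ, each pole can
      avoid its own direction.\<close>
    define j where "j s = (if p (i s) = s then q (i s) else p (i s))" for s
    have j: "j \<in> moves"
    proof -
      have "p (i s) \<noteq> q (i s)" for s using par[of "i s"] i om by blast
      then show ?thesis unfolding moves_def j_def by (simp split: if_splits) metis
    qed
    have fj: "i s + e (j s) \<in> V' \<and> f (i s + e (j s)) = ?g (i 1)" for s
      using par[of "i s"] i[of s] om[of s] by (simp add: j_def)
    have "\<exists>N A. N \<subseteq> f (i 1 + e (j 1)) \<and> cluster N A (\<lambda>s. i s + e (j s))"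
      by (rule tri) (use fj in simp)
    then obtain N A where "N \<subseteq> f (i 1 + e (j 1))" "cluster N A (\<lambda>s. i s + e (j s))"
      by blast
    then show ?thesis
      using fj[of 1] cluster.up[OF _ j] by blast
  next
    case False
    \<comment> \<open>No value from level \<open>H + 1\<close> equals \<open>{i 1}\<close>, so all
      poles are noisy, and equal singletons make them coincide.\<close>
    have "i s = i 1" for s
    proof (cases "\<omega> (i s)")
      case True
      then have "f (i s + e (p (i s))) = {i 1}"
        using i[of s] False by simp
      then show ?thesis
        using notin[of "i 1" "i s + e (p (i s))"] i[of s] i[of 1] par[of "i s"] True by blast
    next
      case n: False
      then show ?thesis using i[of s] False by simp
    qed
    then have "i = (\<lambda>_. i 1)" by (simp add: fun_eq_iff)
    then have "cluster {i 1} 0 i"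
      using cluster.noise[of "i 1"] by simp
    then show ?thesis using False by auto
  qed
  ultimately show ?thesis
    unfolding clustering_def by blast
qed

text \<open>The forks \<open>F\<close> belong to the statement because the induction step needs the
  two zero parents of each site to share a class already.\<close>

lemma zero_clustering:
  assumes "finite V" "\<And>v. v \<in> V \<Longrightarrow> zero n \<omega> v \<and> height v = H"
    and "finite F" "\<And>x y. (x, y) \<in> F \<Longrightarrow> x \<in> V \<and> y \<in> V \<and> fork x y"
  shows "\<exists>f. clustering \<omega> H V f \<and> (\<forall>(x, y)\<in>F. f x = f y)"
  using assms
proof (induction n arbitrary: V F H)
  case 0
  then have "V = {}" by auto
  with 0 show ?case by (auto simp: clustering_def)
next
  case (Suc n)
  have "\<forall>v\<in>V. \<exists>a b. \<omega> v \<longrightarrow> a \<noteq> b \<and> zero n \<omega> (v + e a) \<and> zero n \<omega> (v + e b)"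
    using Suc.prems(2) by auto
  then obtain p q where pq: "\<And>v. v \<in> V \<Longrightarrow> \<omega> v \<Longrightarrow>
      p v \<noteq> q v \<and> zero n \<omega> (v + e (p v)) \<and> zero n \<omega> (v + e (q v))"
    by metis
  let ?W = "{v \<in> V. \<omega> v}"
  let ?V' = "(\<lambda>v. v + e (p v)) ` ?W \<union> (\<lambda>v. v + e (q v)) ` ?W"
  let ?F' = "(\<lambda>v. (v + e (p v), v + e (q v))) ` ?W"
  have "\<exists>f. clustering \<omega> (H + 1) ?V' f \<and> (\<forall>(x, y)\<in>?F'. f x = f y)"
  proof (rule Suc.IH)
    show "finite ?V'" "finite ?F'" using Suc.prems(1) by auto
    show "zero n \<omega> v \<and> height v = H + 1" if "v \<in> ?V'" for v
      using that pq Suc.prems(2) by (auto simp: height_add height_e)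
    show "x \<in> ?V' \<and> y \<in> ?V' \<and> fork x y" if xy: "(x, y) \<in> ?F'" for x y
    proof -
      obtain v where v: "v \<in> ?W" "x = v + e (p v)" "y = v + e (q v)"
        using xy by blast
      have "y + e (p v) = x + e (q v)"
        using v by (simp add: ac_simps)
      then have "fork x y"
        unfolding fork_def by blast
      then show ?thesis using v by blast
    qed
  qed
  then obtain f where f: "clustering \<omega> (H + 1) ?V' f" "\<forall>(x, y)\<in>?F'. f x = f y"
    by blast
  have "clustering \<omega> H V (\<lambda>v. if \<omega> v then f (v + e (p v)) else {v})"
  proof (rule clustering_step[OF _ _ f(1), where q = q])
    show "height v = H" if "v \<in> V" for v using Suc.prems(2) that by blast
    show "p v \<noteq> q v \<and> v + e (p v) \<in> ?V' \<and> v + e (q v) \<in> ?V' \<and>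
        f (v + e (p v)) = f (v + e (q v))" if "v \<in> V" "\<omega> v" for v
      using pq[OF that] f(2) that by auto
  qed
  \<comment> \<open>The forks demanded at the present level are merged only after the
    descent.\<close>
  then show ?case
    by (rule clustering_add_forks[OF Suc.prems(3) _ Suc.prems(4)])
qed

lemma zero_cluster:
  assumes "zero n \<omega> v"
  shows "\<exists>N A. N \<subseteq> {w. \<not> \<omega> w} \<and> cluster N A (\<lambda>_. v)"
proof -
  obtain f where f: "clustering \<omega> (height v) {v} f"
    using zero_clustering[of "{v}" n \<omega> "height v" "{}"] assms by auto
  then have "\<exists>N A. N \<subseteq> f v \<and> cluster N A (\<lambda>_. v)" "f v \<subseteq> {w. \<not> \<omega> w}"
    unfolding clustering_def by auto
  then show ?thesis by blast
qed

section \<open>Contours: explanations with pole 1 moved to the origin\<close>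

definition noise_sites :: "code \<Rightarrow> 'v set" where
  "noise_sites c = (+) (- snd (realize c) 1) ` fst (realize c)"

text \<open>The cardinality condition keeps codes whose leaves are distinct sites, so that their
  noise is independent.\<close>

definition contours :: "nat \<Rightarrow> code set" where
  "contours n = {c \<in> codes n. finite (noise_sites c) \<and> card (noise_sites c) = leaves c \<and>
     ups c < leaves c}"

lemma zero_contour:
  assumes "zero n \<omega> 0"
  shows "\<exists>m. \<exists>c\<in>contours m. \<forall>v\<in>noise_sites c. \<not> \<omega> v"
proof -
  obtain N A where N: "N \<subseteq> {w. \<not> \<omega> w}" "cluster N A (\<lambda>_. 0)"
    using zero_cluster[OF assms] by blast
  obtain c t m where c: "c \<in> codes m" "N = (+) t ` fst (realize c)"
    "(\<lambda>_. 0) = (\<lambda>s. snd (realize c) s + t)" "leaves c = card N" "ups c = A"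
    using cluster_code[OF N(2)] by blast
  have "t = - snd (realize c) 1"
    using fun_cong[OF c(3), of 1] by (simp add: eq_neg_iff_add_eq_0 add.commute)
  then have "noise_sites c = N"
    unfolding noise_sites_def c(2) by simp
  \<comment> \<open>All three poles sit at the origin, so the span is 0.\<close>
  moreover have "A < card N"
    using cluster_ups_bound[OF N(2)] by (simp add: height_def)
  moreover have "finite N"
    using cluster_finite_nonempty[OF N(2)] by blast
  ultimately have "c \<in> contours m" "\<forall>v\<in>noise_sites c. \<not> \<omega> v"
    using c N by (auto simp: contours_def)
  then show ?thesis by blast
qed

lemma contours_mono: "m \<le> n \<Longrightarrow> contours m \<subseteq> contours n"
  using codes_mono by (auto simp: contours_def)

lemma finite_contours: "finite (contours n)"
  using finite_codes by (auto simp: contours_def)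

text \<open>\<open>12000 = 500 * 24\<close>, and having at least one leaf more than moves yields the
  extra factor \<open>1 / 24\<close>.\<close>

lemma contour_noise_le_weight:
  assumes "c \<in> contours n"
  shows "(1 / 12000 :: real) ^ card (noise_sites c) \<le> weight c / 24"
proof -
  have "Suc (ups c) \<le> leaves c" and card: "card (noise_sites c) = leaves c"
    using assms by (auto simp: contours_def)
  then have "(1 / 24 :: real) ^ leaves c \<le> (1 / 24) ^ Suc (ups c)"
    by (intro power_decreasing) auto
  then have "(1 / 500 :: real) ^ leaves c * (1 / 24) ^ leaves c
      \<le> (1 / 500) ^ leaves c * (1 / 24) ^ Suc (ups c)"
    by (intro mult_left_mono) auto
  then show ?thesis
    by (simp add: card weight_def power_mult_distrib[symmetric])
qed

end

section \<open>From contours to the critical parameter\<close>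

lemma add3_eq_plus: "add3 x y = x + y"
  by (cases x; cases y) simp

text \<open>Self-duality of majority: zeros spread by the same rule as ones.\<close>

lemma two_true_iff_not_two_false:
  "(\<exists>a b. a \<noteq> b \<and> P a \<and> P b) \<longleftrightarrow> \<not> (\<exists>a b. a \<noteq> b \<and> \<not> P a \<and> \<not> P b)" for P :: "3 \<Rightarrow> bool"
  unfolding ex_3 by auto

locale majority_automaton = majority_lattice e l
  for e :: "3 \<Rightarrow> site" and l :: "3 \<Rightarrow> site \<Rightarrow> int" +
  fixes phi :: "config \<Rightarrow> bool"
  assumes phi_majority: "phi x \<longleftrightarrow> (\<exists>a b. a \<noteq> b \<and> x (e a) \<and> x (e b))"
begin

lemma traj_op_alt:
  "traj_op phi \<omega> x v \<longleftrightarrow> \<omega> v \<and> (\<exists>a b. a \<noteq> b \<and> x (v + e a) \<and> x (v + e b))"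
  by (simp add: traj_op_def phi_majority add3_eq_plus)

lemma mono_traj_op: "mono (traj_op phi \<omega>)"
  unfolding mono_def le_fun_def le_bool_def traj_op_alt by blast

text \<open>Each site has only three parents, so zeros arise at finite stages. Hence the sites that
  never become zero form a post-fixed point of \<open>traj_op\<close>, and \<open>gfp\<close> is the
  largest one.\<close>

lemma max_traj_iff: "max_traj phi \<omega> v \<longleftrightarrow> (\<forall>n. \<not> zero n \<omega> v)"
proof
  have fix_eq: "max_traj phi \<omega> = traj_op phi \<omega> (max_traj phi \<omega>)"
    unfolding max_traj_def by (rule gfp_unfold[OF mono_traj_op])
  have "\<not> zero n \<omega> v" if "max_traj phi \<omega> v" for n v
    using that
  proof (induction n arbitrary: v)
    case (Suc n)
    have *: "\<omega> v" "\<exists>a b. a \<noteq> b \<and> max_traj phi \<omega> (v + e a) \<and> max_traj phi \<omega> (v + e b)"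
      using Suc.prems fun_cong[OF fix_eq, of v] traj_op_alt by metis+
    then have "\<exists>a b. a \<noteq> b \<and> \<not> zero n \<omega> (v + e a) \<and> \<not> zero n \<omega> (v + e b)"
      using Suc.IH by blast
    then show ?case
      using * two_true_iff_not_two_false[of "\<lambda>a. \<not> zero n \<omega> (v + e a)"] by simp
  qed simp
  then show "max_traj phi \<omega> v \<Longrightarrow> \<forall>n. \<not> zero n \<omega> v" by blast
next
  let ?X = "\<lambda>v. \<forall>n. \<not> zero n \<omega> v"
  have "?X \<le> traj_op phi \<omega> ?X"
  proof (intro le_funI le_boolI)
    fix v assume v: "?X v"
    have om: "\<omega> v"
      using v zero.simps(2)[of 0 \<omega> v] by blast
    have "\<not> (\<exists>a b. a \<noteq> b \<and> \<not> ?X (v + e a) \<and> \<not> ?X (v + e b))"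
    proof
      assume "\<exists>a b. a \<noteq> b \<and> \<not> ?X (v + e a) \<and> \<not> ?X (v + e b)"
      then obtain a b m n where "a \<noteq> b" "zero m \<omega> (v + e a)" "zero n \<omega> (v + e b)"
        by blast
      \<comment> \<open>The two zero parents may appear at different stages; the later stage serves
        for both.\<close>
      then have "zero (Suc (max m n)) \<omega> v"
        using zero_mono[of m "max m n" \<omega> "v + e a"] zero_mono[of n "max m n" \<omega> "v + e b"]
        unfolding zero.simps by (meson max.cobounded1 max.cobounded2)
      with v show False by blast
    qed
    then show "traj_op phi \<omega> ?X v"
      unfolding traj_op_alt using om two_true_iff_not_two_false[of "\<lambda>a. ?X (v + e a)"] by blast
  qed
  then have "?X \<le> max_traj phi \<omega>"
    unfolding max_traj_def by (rule gfp_upperbound)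
  then show "\<forall>n. \<not> zero n \<omega> v \<Longrightarrow> max_traj phi \<omega> v"
    by (rule le_funD[THEN le_boolD, rule_format])
qed

lemma measurable_zero [measurable]: "Measurable.pred (noise p) (\<lambda>\<omega>. zero n \<omega> v)"
proof (induction n arbitrary: v)
  case (Suc n)
  have [measurable]: "Measurable.pred (noise p) (\<lambda>\<omega>. zero n \<omega> w)" for w
    by (rule Suc)
  have [measurable]: "Measurable.pred (noise p) (\<lambda>\<omega>. \<omega> v)"
  proof -
    have "(\<lambda>\<omega>. \<omega> v) \<in> noise p \<rightarrow>\<^sub>M measure_pmf (bernoulli_pmf (1 - p))"
      unfolding noise_def by (rule measurable_component_singleton) simp
    then show ?thesis
      by (simp add: measurable_def)
  qed
  show ?case
    unfolding zero.simps by measurable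
qed simp

lemma measurable_max_traj: "{\<omega> \<in> space (noise p). max_traj phi \<omega> v} \<in> sets (noise p)"
  unfolding max_traj_iff by measurable

lemma prob_all_noise:
  assumes "finite N" "0 \<le> p" "p \<le> 1"
  shows "{\<omega> \<in> space (noise p). \<forall>v\<in>N. \<not> \<omega> v} \<in> sets (noise p)"
    and "measure (noise p) {\<omega> \<in> space (noise p). \<forall>v\<in>N. \<not> \<omega> v} = p ^ card N"
proof -
  interpret product_prob_space "\<lambda>_::site. measure_pmf (bernoulli_pmf (1 - p))" UNIV
    by unfold_locales
  have eq: "{\<omega> \<in> space (noise p). \<forall>v\<in>N. \<not> \<omega> v} = {\<omega> \<in> space (noise p). \<forall>v\<in>N. \<omega> v \<in> {False}}"
    by auto
  show "{\<omega> \<in> space (noise p). \<forall>v\<in>N. \<not> \<omega> v} \<in> sets (noise p)"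
    unfolding eq noise_def using assms(1) by measurable
  have "emeasure (noise p) {\<omega> \<in> space (noise p). \<forall>v\<in>N. \<omega> v \<in> {False}}
      = (\<Prod>v\<in>N. emeasure (measure_pmf (bernoulli_pmf (1 - p))) {False})"
    unfolding noise_def using assms(1) by (intro emeasure_PiM_Collect) auto
  also have "\<dots> = ennreal (p ^ card N)"
    using assms by (simp add: emeasure_pmf_single ennreal_power)
  finally show "measure (noise p) {\<omega> \<in> space (noise p). \<forall>v\<in>N. \<not> \<omega> v} = p ^ card N"
    unfolding eq using assms by (simp add: measure_def)
qed

lemma p_crit_ge: "1 / 12000 \<le> p_crit phi"
proof -
  let ?p = "1 / 12000 :: real"
  let ?M = "noise ?p"
  interpret prob_space ?M
    unfolding noise_def by (intro prob_space_PiM measure_pmf.prob_space_axioms)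
  define E where "E c = {\<omega> \<in> space ?M. \<forall>v\<in>noise_sites c. \<not> \<omega> v}" for c
  define U where "U n = (\<Union>c\<in>contours n. E c)" for n
  have E: "E c \<in> events" "prob (E c) \<le> weight c / 24" if "c \<in> contours n" for c n
    using prob_all_noise[of "noise_sites c" ?p] contour_noise_le_weight[OF that] that
    by (auto simp: E_def contours_def)
  have U: "U n \<in> events" for n
    unfolding U_def using E finite_contours by (intro sets.finite_UN) auto
  have probU: "prob (U n) \<le> 1 / 4800" for n
  proof -
    have "prob (U n) \<le> (\<Sum>c\<in>contours n. prob (E c))"
      unfolding U_def using E finite_contours by (intro finite_measure_subadditive_finite) auto
    also have "\<dots> \<le> (\<Sum>c\<in>contours n. weight c / 24)"
      using E by (intro sum_mono) auto
    also have "\<dots> \<le> (\<Sum>c\<in>codes n. weight c / 24)"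
      by (intro sum_mono2 finite_codes) (auto simp: contours_def weight_nonneg)
    also have "\<dots> \<le> 1 / 4800"
      using sum_weight_codes_le[of n] by (simp add: sum_divide_distrib[symmetric])
    finally show ?thesis .
  qed
  \<comment> \<open>Continuity from below carries the uniform bound to the union over all
    contours.\<close>
  have "incseq U"
    unfolding U_def incseq_def using contours_mono by blast
  then have "(\<lambda>n. prob (U n)) \<longlonglongrightarrow> prob (\<Union>n. U n)"
    using U by (intro finite_Lim_measure_incseq) auto
  then have probUN: "prob (\<Union>n. U n) \<le> 1 / 4800"
    using probU by (intro LIMSEQ_le_const2[of "\<lambda>n. prob (U n)"]) auto
  have "space ?M - {\<omega> \<in> space ?M. max_traj phi \<omega> (0, 0, 0)} \<subseteq> (\<Union>n. U n)"
  proof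
    fix \<omega> assume "\<omega> \<in> space ?M - {\<omega> \<in> space ?M. max_traj phi \<omega> (0, 0, 0)}"
    then obtain n where "\<omega> \<in> space ?M" "zero n \<omega> 0"
      by (auto simp: max_traj_iff zero_prod_def)
    then show "\<omega> \<in> (\<Union>n. U n)"
      using zero_contour[of n \<omega>] by (auto simp: U_def E_def)
  qed
  then have "prob (space ?M - {\<omega> \<in> space ?M. max_traj phi \<omega> (0, 0, 0)}) \<le> prob (\<Union>n. U n)"
    using U by (intro finite_measure_mono) auto
  \<comment> \<open>The density is at least \<open>1 - 1/4800\<close>, so \<open>?p\<close> itself
    lies in the set whose supremum is \<open>p_crit\<close>.\<close>
  then have "0 < rho_bar phi ?p"
    using probUN prob_compl[OF measurable_max_traj[of ?p "(0, 0, 0)"]] by (simp add: rho_bar_def)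
  then have "?p \<in> {p. 0 \<le> p \<and> p \<le> 1 \<and> rho_bar phi p > 0}"
    by simp
  then show ?thesis
    unfolding p_crit_def by (rule cSup_upper) (auto intro!: bdd_aboveI[of _ 1])
qed

end

section \<open>The two rules\<close>

lemma round_third_eq_1_iff:
  "round ((of_bool a + of_bool b + of_bool c) / 3 :: real) = 1 \<longleftrightarrow> a \<and> b \<or> a \<and> c \<or> b \<and> c"
  by (cases a; cases b; cases c) (simp_all add: round_def floor_eq_iff)

definition dir_a :: "3 \<Rightarrow> site" where
  "dir_a s = (if s = 1 then (1, 0, 0) else if s = 2 then (0, 1, 0) else (0, 0, 1))"

definition coord_a :: "3 \<Rightarrow> site \<Rightarrow> int" where
  "coord_a s = (\<lambda>(x, y, z). if s = 1 then x else if s = 2 then y else z)"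

definition dir_b :: "3 \<Rightarrow> site" where
  "dir_b s = (if s = 1 then (1, 0, -1) else if s = 2 then (0, 1, -1) else (0, 0, -1))"

text \<open>The third functional completes the basis dual to \<open>dir_b\<close>; the three sum to
  \<open>- z\<close>, the height function of rule (b).\<close>

definition coord_b :: "3 \<Rightarrow> site \<Rightarrow> int" where
  "coord_b s = (\<lambda>(x, y, z). if s = 1 then x else if s = 2 then y else - x - y - z)"

lemma majority_automaton_a: "majority_automaton dir_a coord_a phi_a"
proof
  show "coord_a s (x + y) = coord_a s x + coord_a s y" for s x y
    by (auto simp: coord_a_def split: prod.split)
  show "coord_a s (dir_a t) = of_bool (s = t)" for s t
    using exhaust_3[of s] exhaust_3[of t] by (auto simp: coord_a_def dir_a_def)
  show "phi_a x \<longleftrightarrow> (\<exists>a b. a \<noteq> b \<and> x (dir_a a) \<and> x (dir_a b))" for x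
    unfolding phi_a_def round_third_eq_1_iff ex_3 by (auto simp: dir_a_def)
qed

lemma majority_automaton_b: "majority_automaton dir_b coord_b phi_b"
proof
  show "coord_b s (x + y) = coord_b s x + coord_b s y" for s x y
    by (auto simp: coord_b_def split: prod.split)
  show "coord_b s (dir_b t) = of_bool (s = t)" for s t
    using exhaust_3[of s] exhaust_3[of t] by (auto simp: coord_b_def dir_b_def)
  show "phi_b x \<longleftrightarrow> (\<exists>a b. a \<noteq> b \<and> x (dir_b a) \<and> x (dir_b b))" for x
    unfolding phi_b_def round_third_eq_1_iff ex_3 by (auto simp: dir_b_def)
qed

theorem theorem1:
  shows "1 / 12000 \<le> p_crit phi_a \<and> 1 / 12000 \<le> p_crit phi_b"
  using majority_automaton.p_crit_ge[OF majority_automaton_a]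
    majority_automaton.p_crit_ge[OF majority_automaton_b] by blast

end
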